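(* For every constant $c>0$ there exist constants $0<a\le A$ depending only on $c$ such that for all positive integers $S,n$ with $n\ge cS$, the plug-in (maximum likelihood) estimator $\|P_n-Q_n\|_1=\sum_{i=1}^S|\hat p_i-\hat q_i|$ satisfies $$a\,\frac Sn\le\sup_{P,Q\in\mathcal{M}_S}\mathbb{E}\big|\|P_n-Q_n\|_1-\|P-Q\|_1\big|^2\le A\,\frac Sn .$$
   Context: $\mathcal{M}_S$ is the set of probability vectors on $\{1,\dots,S\}$; $\|P-Q\|_1=\sum_{i=1}^S|p_i-q_i|$. Poisson sampling model with both $P=(p_i)$ and $Q=(q_i)$ unknown: one observes mutually independent $X_i\sim\mathrm{Poi}(np_i)$, $Y_i\sim\mathrm{Poi}(nq_i)$, $1\le i\le S$; $\hat p_i=X_i/n$, $\hat q_i=Y_i/n$, $P_n=(\hat p_i)$, $Q_n=(\hat q_i)$. *)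

theory Defs
  imports "HOL-Probability.Probability"
begin

definition prob_vectors :: "nat \<Rightarrow> (nat \<Rightarrow> real) set" where
  "prob_vectors S =
     {p. (\<forall>i\<in>{1..S}. 0 \<le> p i) \<and> (\<forall>i. i \<notin> {1..S} \<longrightarrow> p i = 0) \<and> (\<Sum>i=1..S. p i) = 1}"

definition l1_dist :: "nat \<Rightarrow> (nat \<Rightarrow> real) \<Rightarrow> (nat \<Rightarrow> real) \<Rightarrow> real" where
  "l1_dist S p q = (\<Sum>i=1..S. \<bar>p i - q i\<bar>)"

text \<open>
  The library's \<^const>\<open>poisson_pmf\<close> is only specified for positive rates, whereas probability
  vectors may have zero entries; the Poisson law with rate 0 is the point mass at 0.
\<close>

definition Poi :: "real \<Rightarrow> nat pmf" where
  "Poi r = (if r = 0 then return_pmf 0 else poisson_pmf r)"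

lemma pmf_Poi:
  assumes "0 \<le> r"
  shows "pmf (Poi r) k = r ^ k / fact k * exp (- r)"
  using assms by (cases "k = 0") (auto simp: Poi_def)

text \<open>
  The joint law of the two families of counts: all \<open>X i\<close> and \<open>Y i\<close>, for \<open>i\<close> in \<open>{1..S}\<close>,
  are mutually independent (both families are 0 outside \<open>{1..S}\<close>).
\<close>

definition poisson_sampling ::
  "nat \<Rightarrow> nat \<Rightarrow> (nat \<Rightarrow> real) \<Rightarrow> (nat \<Rightarrow> real) \<Rightarrow> ((nat \<Rightarrow> nat) \<times> (nat \<Rightarrow> nat)) pmf" where
  "poisson_sampling S n p q =
     pair_pmf (Pi_pmf {1..S} 0 (\<lambda>i. Poi (real n * p i)))
              (Pi_pmf {1..S} 0 (\<lambda>i. Poi (real n * q i)))"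

definition empirical :: "nat \<Rightarrow> (nat \<Rightarrow> nat) \<Rightarrow> nat \<Rightarrow> real" where
  "empirical n X = (\<lambda>i. real (X i) / real n)"

definition plug_in :: "nat \<Rightarrow> nat \<Rightarrow> (nat \<Rightarrow> nat) \<Rightarrow> (nat \<Rightarrow> nat) \<Rightarrow> real" where
  "plug_in S n X Y = l1_dist S (empirical n X) (empirical n Y)"

text \<open>
  The expectation and the supremum are taken in the extended nonnegative reals, so that
  integrability and boundedness are part of any finite upper bound.
\<close>

definition plug_in_risk :: "nat \<Rightarrow> nat \<Rightarrow> (nat \<Rightarrow> real) \<Rightarrow> (nat \<Rightarrow> real) \<Rightarrow> ennreal" where
  "plug_in_risk S n p q =
     (\<integral>\<^sup>+ \<omega>. ennreal (\<bar>plug_in S n (fst \<omega>) (snd \<omega>) - l1_dist S p q\<bar>\<^sup>2)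
        \<partial>measure_pmf (poisson_sampling S n p q))"

definition plug_in_max_risk :: "nat \<Rightarrow> nat \<Rightarrow> ennreal" where
  "plug_in_max_risk S n =
     (SUP (p, q) \<in> prob_vectors S \<times> prob_vectors S. plug_in_risk S n p q)"

end

theory Submission
  imports Defs
begin

text \<open>
  Neither bound needs a fine analysis of the absolute value.

  Upper bound. By the triangle inequality the error is at most
  \<open>\<Sum>i. \<bar>(X i - Y i) / n - (p i - q i)\<bar>\<close>, and Cauchy--Schwarz over the \<open>S\<close> coordinates bounds its
  square by \<open>S\<close> times a sum of squared deviations. Each coordinate contributes at most twice the
  variances of \<open>X i / n\<close> and \<open>Y i / n\<close>, which are \<open>p i / n\<close> and \<open>q i / n\<close>; as these sum to
  \<open>2 / n\<close>, the risk is at most \<open>4 * S / n\<close> (\<open>plug_in_risk_le\<close>).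

  Lower bound. Take \<open>P = Q\<close> uniform. The target is then zero while the estimator is a sum of
  nonnegative terms, so its bias alone is large: the risk is at least the square of
  \<open>(S / n) * E\<bar>X - Y\<bar>\<close> with \<open>X\<close>, \<open>Y\<close> independent Poisson of rate \<open>\<lambda> = n / S \<ge> c\<close>. Averaging over
  \<open>Y\<close> first gives \<open>E\<bar>X - Y\<bar> \<ge> E\<bar>X - \<lambda>\<bar>\<close> (\<open>Poi_mean_abs_difference_ge\<close>), and the
  second and fourth central moments of the Poisson law force \<open>E\<bar>X - \<lambda>\<bar>\<close> to have order \<open>\<surd>\<lambda>\<close> once
  \<open>\<lambda>\<close> is bounded away from zero (\<open>Poi_mean_abs_deviation_ge\<close>). This makes the risk at least of order
  \<open>(S / n)\<^sup>2 * (n / S) = S / n\<close> (\<open>plug_in_risk_uniform_ge\<close>).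
\<close>

section \<open>Moments of the Poisson law\<close>

text \<open>
  The Chen--Stein identity. It reduces every factorial moment to the preceding one, since
  the falling factorial of \<open>x + 1\<close> of order \<open>m + 1\<close> is \<open>x + 1\<close> times that of \<open>x\<close> of order \<open>m\<close>.
\<close>

lemma nn_integral_Poi_Chen_Stein:
  fixes g :: "nat \<Rightarrow> ennreal"
  assumes "0 \<le> r"
  shows "(\<integral>\<^sup>+ x. of_nat x * g x \<partial>Poi r) = ennreal r * (\<integral>\<^sup>+ x. g (Suc x) \<partial>Poi r)"
proof -
  have step: "ennreal (pmf (Poi r) (Suc k)) * of_nat (Suc k) = ennreal r * ennreal (pmf (Poi r) k)" for k
  proof -
    have "pmf (Poi r) (Suc k) * real (Suc k) = r * pmf (Poi r) k"
      using assms by (simp add: pmf_Poi divide_simps del: of_nat_Suc)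
    then show ?thesis
      using assms by (simp add: ennreal_of_nat_eq_real_of_nat ennreal_mult[symmetric] del: of_nat_Suc)
  qed
  have "(\<integral>\<^sup>+ x. of_nat x * g x \<partial>Poi r) = (\<Sum>k. ennreal (pmf (Poi r) k) * (of_nat k * g k))"
    by (simp add: nn_integral_measure_pmf nn_integral_count_space_nat)
  also have "\<dots> = (\<Sum>k. ennreal (pmf (Poi r) (Suc k)) * (of_nat (Suc k) * g (Suc k)))"
    by (subst suminf_offset[of _ 1]) (auto simp del: of_nat_Suc)
  also have "\<dots> = (\<Sum>k. ennreal r * (ennreal (pmf (Poi r) k) * g (Suc k)))"
    by (simp only: mult.assoc[symmetric] step)
  also have "\<dots> = ennreal r * (\<integral>\<^sup>+ x. g (Suc x) \<partial>Poi r)"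
    by (simp add: nn_integral_measure_pmf nn_integral_count_space_nat)
  finally show ?thesis .
qed

lemma has_bochner_integral_Poi_falling_factorial:
  assumes "0 \<le> r"
  shows "has_bochner_integral (Poi r) (\<lambda>x. real (\<Prod>j<m. x - j)) (r ^ m)"
proof -
  have "(\<integral>\<^sup>+ x. ennreal (real (\<Prod>j<m. x - j)) \<partial>Poi r) = ennreal (r ^ m)"
  proof (induction m)
    case 0
    show ?case by simp
  next
    case (Suc m)
    let ?g = "\<lambda>x. ennreal (real (\<Prod>j<m. x - Suc j))"
    have "(\<integral>\<^sup>+ x. ennreal (real (\<Prod>j<Suc m. x - j)) \<partial>Poi r) = (\<integral>\<^sup>+ x. of_nat x * ?g x \<partial>Poi r)"
      by (simp add: prod.lessThan_Suc_shift ennreal_of_nat_eq_real_of_nat ennreal_mult prod_nonneg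
          del: prod.lessThan_Suc)
    also have "\<dots> = ennreal r * ennreal (r ^ m)"
      using Suc by (simp add: nn_integral_Poi_Chen_Stein assms)
    finally show ?case
      using assms by (simp add: ennreal_mult del: prod.lessThan_Suc)
  qed
  then show ?thesis
    using assms by (intro has_bochner_integral_nn_integral) (auto simp: prod_nonneg)
qed

lemma has_bochner_integral_Poi_powers:
  assumes "0 \<le> r"
  shows "has_bochner_integral (Poi r) (\<lambda>x. 1 :: real) 1"
    and "has_bochner_integral (Poi r) real r"
    and "has_bochner_integral (Poi r) (\<lambda>x. real x ^ 2) (r^2 + r)"
    and "has_bochner_integral (Poi r) (\<lambda>x. real x ^ 3) (r^3 + 3 * r^2 + r)"
    and "has_bochner_integral (Poi r) (\<lambda>x. real x ^ 4) (r^4 + 6 * r^3 + 7 * r^2 + r)"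
proof -
  define F where "F m x = real (\<Prod>j<m. x - j)" for m x :: nat
  have F: "has_bochner_integral (Poi r) (F m) (r ^ m)" for m
    unfolding F_def by (rule has_bochner_integral_Poi_falling_factorial[OF assms])
  have F1: "F 1 x = real x" for x
    by (simp add: F_def)
  have F2: "F 2 x = real x * (real x - 1)" for x
    by (cases x) (auto simp: F_def numeral_eq_Suc algebra_simps)
  have F3: "F 3 x = F 2 x * (real x - 2)" for x
  proof (cases "x < 2")
    case True
    then show ?thesis by (auto simp: F_def numeral_eq_Suc)
  qed (auto simp: F_def numeral_eq_Suc of_nat_diff)
  have F4: "F 4 x = F 3 x * (real x - 3)" for x
  proof (cases "x < 3")
    case True
    then show ?thesis by (auto simp: F_def numeral_eq_Suc less_Suc_eq)
  qed (auto simp: F_def numeral_eq_Suc of_nat_diff)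
  show "has_bochner_integral (Poi r) (\<lambda>x. 1 :: real) 1"
    using F[of 0] by (simp add: F_def[abs_def])
  show "has_bochner_integral (Poi r) real r"
    using F[of 1] by (simp add: F_def[abs_def])
  have "has_bochner_integral (Poi r) (\<lambda>x. F 2 x + F 1 x) (r^2 + r^1)"
    by (intro has_bochner_integral_add F)
  also have "(\<lambda>x. F 2 x + F 1 x) = (\<lambda>x. real x ^ 2)"
    by (simp add: fun_eq_iff F1[simplified] F2 power2_eq_square algebra_simps)
  finally show "has_bochner_integral (Poi r) (\<lambda>x. real x ^ 2) (r^2 + r)" by simp
  \<comment> \<open>Powers expand in falling factorials with Stirling numbers of the second kind as coefficients.\<close>
  have "has_bochner_integral (Poi r) (\<lambda>x. F 3 x + 3 * F 2 x + F 1 x) (r^3 + 3 * r^2 + r^1)"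
    by (intro has_bochner_integral_add has_bochner_integral_mult_right F)
  also have "(\<lambda>x. F 3 x + 3 * F 2 x + F 1 x) = (\<lambda>x. real x ^ 3)"
    by (simp add: fun_eq_iff F1[simplified] F2 F3 power3_eq_cube algebra_simps)
  finally show "has_bochner_integral (Poi r) (\<lambda>x. real x ^ 3) (r^3 + 3 * r^2 + r)" by simp
  have "has_bochner_integral (Poi r) (\<lambda>x. F 4 x + 6 * F 3 x + 7 * F 2 x + F 1 x)
      (r^4 + 6 * r^3 + 7 * r^2 + r^1)"
    by (intro has_bochner_integral_add has_bochner_integral_mult_right F)
  also have "(\<lambda>x. F 4 x + 6 * F 3 x + 7 * F 2 x + F 1 x) = (\<lambda>x. real x ^ 4)"
    by (simp add: fun_eq_iff F1[simplified] F2 F3 F4 power4_eq_xxxx algebra_simps)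
  finally show "has_bochner_integral (Poi r) (\<lambda>x. real x ^ 4) (r^4 + 6 * r^3 + 7 * r^2 + r)" by simp
qed

lemma has_bochner_integral_Poi_centered_square:
  assumes "0 \<le> r"
  shows "has_bochner_integral (Poi r) (\<lambda>x. (real x - r)^2) r"
proof -
  have "has_bochner_integral (Poi r) (\<lambda>x. real x ^ 2 + (- 2 * r) * real x + r^2 * 1)
      ((r^2 + r) + (- 2 * r) * r + r^2 * 1)"
    by (intro has_bochner_integral_add has_bochner_integral_mult_right has_bochner_integral_Poi_powers assms)
  then show ?thesis
    by (simp add: power2_eq_square algebra_simps)
qed

lemma has_bochner_integral_Poi_centered_fourth_power:
  assumes "0 \<le> r"
  shows "has_bochner_integral (Poi r) (\<lambda>x. (real x - r)^4) (r + 3 * r^2)"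
proof -
  have "has_bochner_integral (Poi r)
      (\<lambda>x. real x ^ 4 + (- 4 * r) * real x ^ 3 + (6 * r^2) * real x ^ 2 + (- 4 * r^3) * real x + r^4 * 1)
      ((r^4 + 6 * r^3 + 7 * r^2 + r) + (- 4 * r) * (r^3 + 3 * r^2 + r) + (6 * r^2) * (r^2 + r)
        + (- 4 * r^3) * r + r^4 * 1)"
    by (intro has_bochner_integral_add has_bochner_integral_mult_right has_bochner_integral_Poi_powers assms)
  also have "(\<lambda>x. real x ^ 4 + (- 4 * r) * real x ^ 3 + (6 * r^2) * real x ^ 2 + (- 4 * r^3) * real x + r^4 * 1)
      = (\<lambda>x. (real x - r)^4)"
    by (simp add: fun_eq_iff power2_eq_square power3_eq_cube power4_eq_xxxx algebra_simps)
  also have "(r^4 + 6 * r^3 + 7 * r^2 + r) + (- 4 * r) * (r^3 + 3 * r^2 + r) + (6 * r^2) * (r^2 + r)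
        + (- 4 * r^3) * r + r^4 * 1 = r + 3 * r^2"
    by (simp add: power2_eq_square power3_eq_cube power4_eq_xxxx algebra_simps)
  finally show ?thesis .
qed

lemma nn_integral_Poi_centered_square:
  assumes "0 \<le> r"
  shows "(\<integral>\<^sup>+ x. ennreal ((real x - r)^2) \<partial>Poi r) = ennreal r"
  using has_bochner_integral_Poi_centered_square[OF assms]
  by (subst nn_integral_eq_integral) (auto simp: has_bochner_integral_iff)

section \<open>Mean absolute deviations\<close>

text \<open>
  Integrating the elementary inequality \<open>\<bar>u\<bar> \<ge> u\<^sup>2 / t - u^4 / t^3\<close> turns bounds on even moments into a
  lower bound on the first absolute moment; it replaces an interpolation by Hoelder's inequality.
\<close>

lemma Poi_mean_abs_deviation_ge:
  assumes "0 \<le> r"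
  shows "r / (2 * sqrt (2 * (1 + 3 * r))) \<le> (\<integral>x. \<bar>real x - r\<bar> \<partial>Poi r)"
proof -
  \<comment> \<open>With this scale the fourth moment term costs exactly half of the second moment term.\<close>
  define t where "t = sqrt (2 * (1 + 3 * r))"
  have t: "t > 0" and t2: "t^2 = 2 * (1 + 3 * r)"
    using assms by (auto simp: t_def)
  have pointwise: "u^2 / t - u^4 / t^3 \<le> \<bar>u\<bar>" for u :: real
  proof -
    define v where "v = \<bar>u\<bar> / t"
    have v: "v \<ge> 0" and u: "\<bar>u\<bar> = v * t"
      using t by (auto simp: v_def)
    have "1 - v + v^3 \<ge> 0"
    proof (cases "v \<le> 1")
      case False
      then have "v * 1 \<le> v * v^2"
        by (intro mult_left_mono) (auto simp: one_le_power)
      then show ?thesis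
        by (simp add: power3_eq_cube power2_eq_square)
    qed (use v in \<open>simp add: add_nonneg_nonneg\<close>)
    then have "0 \<le> (v * t) * (1 - v + v^3)"
      using v t by (intro mult_nonneg_nonneg) auto
    moreover have "u^2 / t = v^2 * t" "u^4 / t^3 = v^4 * t"
    proof -
      have "u^2 = (v * t)^2" and "u^4 = (v * t)^4"
        unfolding u[symmetric] by (simp_all add: power_even_abs)
      then show "u^2 / t = v^2 * t" "u^4 / t^3 = v^4 * t"
        using t by (simp_all add: field_simps power2_eq_square power3_eq_cube power4_eq_xxxx)
    qed
    ultimately show ?thesis
      by (simp add: u algebra_simps power2_eq_square power3_eq_cube power4_eq_xxxx)
  qed
  have abs_integrable: "integrable (Poi r) (\<lambda>x. \<bar>real x - r\<bar>)"
    using has_bochner_integral_Poi_powers(2)[OF assms] by (auto simp: has_bochner_integral_iff)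
  have minorant: "has_bochner_integral (Poi r) (\<lambda>x. (real x - r)^2 / t - (real x - r)^4 / t^3)
      (r / t - (r + 3 * r^2) / t^3)"
    by (intro has_bochner_integral_diff has_bochner_integral_divide
        has_bochner_integral_Poi_centered_square has_bochner_integral_Poi_centered_fourth_power assms)
  have "r / (2 * t) = r / t - (r + 3 * r^2) / t^3"
  proof -
    have "(r + 3 * r^2) / t^3 = r * (1 + 3 * r) / (t^2 * t)"
      by (simp add: power2_eq_square power3_eq_cube algebra_simps)
    also have "\<dots> = r / (2 * t)"
      using assms t by (simp add: t2 divide_simps)
    finally show ?thesis by simp
  qed
  also have "\<dots> = (\<integral>x. (real x - r)^2 / t - (real x - r)^4 / t^3 \<partial>Poi r)"
    using minorant by (simp add: has_bochner_integral_integral_eq)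
  also have "\<dots> \<le> (\<integral>x. \<bar>real x - r\<bar> \<partial>Poi r)"
    using minorant abs_integrable pointwise
    by (intro integral_mono) (auto simp: has_bochner_integral_iff)
  finally show ?thesis
    by (simp add: t_def)
qed

text \<open>
  Jensen's inequality, applied to the average over the second variable with the first one held
  fixed, replaces the second variable by its mean.
\<close>

lemma Poi_mean_abs_difference_ge:
  assumes "0 \<le> r"
  shows "ennreal (r / (2 * sqrt (2 * (1 + 3 * r))))
    \<le> (\<integral>\<^sup>+ z. ennreal \<bar>real (fst z) - real (snd z)\<bar> \<partial>pair_pmf (Poi r) (Poi r))"
proof -
  have int: "integrable (Poi r) real" and mean: "(\<integral>y. real y \<partial>Poi r) = r"
    using has_bochner_integral_Poi_powers(2)[OF assms] by (auto simp: has_bochner_integral_iff)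
  have jensen: "ennreal \<bar>real x - r\<bar> \<le> (\<integral>\<^sup>+ y. ennreal \<bar>real x - real y\<bar> \<partial>Poi r)" for x :: nat
  proof -
    have "\<bar>real x - r\<bar> = \<bar>\<integral>y. real x - real y \<partial>Poi r\<bar>"
      using int mean by simp
    also have "\<dots> \<le> (\<integral>y. \<bar>real x - real y\<bar> \<partial>Poi r)"
      by (rule integral_abs_bound)
    finally show ?thesis
      using int by (subst nn_integral_eq_integral) (auto intro!: ennreal_leI)
  qed
  have "ennreal (r / (2 * sqrt (2 * (1 + 3 * r)))) \<le> ennreal (\<integral>x. \<bar>real x - r\<bar> \<partial>Poi r)"
    by (intro ennreal_leI Poi_mean_abs_deviation_ge assms)
  also have "\<dots> = (\<integral>\<^sup>+ x. ennreal \<bar>real x - r\<bar> \<partial>Poi r)"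
    using int by (subst nn_integral_eq_integral) auto
  also have "\<dots> \<le> (\<integral>\<^sup>+ x. \<integral>\<^sup>+ y. ennreal \<bar>real x - real y\<bar> \<partial>Poi r \<partial>Poi r)"
    by (intro nn_integral_mono jensen)
  also have "\<dots> = (\<integral>\<^sup>+ z. ennreal \<bar>real (fst z) - real (snd z)\<bar> \<partial>pair_pmf (Poi r) (Poi r))"
    by (simp add: nn_integral_pair_pmf')
  finally show ?thesis .
qed

section \<open>The risk of the plug-in estimator\<close>

lemma map_poisson_sampling_component:
  assumes "i \<in> {1..S}"
  shows "map_pmf (\<lambda>\<omega>. (fst \<omega> i, snd \<omega> i)) (poisson_sampling S n p q)
    = pair_pmf (Poi (real n * p i)) (Poi (real n * q i))"
proof -
  have "map_pmf (\<lambda>\<omega>. (fst \<omega> i, snd \<omega> i)) (poisson_sampling S n p q)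
      = map_pmf (\<lambda>(f, g). (f i, g i)) (poisson_sampling S n p q)"
    by (simp add: case_prod_unfold)
  then show ?thesis
    using assms by (simp add: poisson_sampling_def map_pair Pi_pmf_component)
qed

lemma nn_integral_poisson_sampling_component:
  assumes "i \<in> {1..S}"
  shows "(\<integral>\<^sup>+ \<omega>. f (fst \<omega> i) (snd \<omega> i) \<partial>poisson_sampling S n p q)
    = (\<integral>\<^sup>+ z. f (fst z) (snd z) \<partial>pair_pmf (Poi (real n * p i)) (Poi (real n * q i)))"
  by (simp add: map_poisson_sampling_component[OF assms, symmetric])

lemma nn_integral_pair_centered_squares:
  assumes "0 \<le> p" "0 \<le> q" "0 < n"
  shows "(\<integral>\<^sup>+ z. ennreal ((real (fst z) - n * p)^2 + (real (snd z) - n * q)^2)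
      \<partial>pair_pmf (Poi (n * p)) (Poi (n * q))) = ennreal (n * (p + q))"
proof -
  have "(\<integral>\<^sup>+ z. ennreal ((real (fst z) - n * p)^2 + (real (snd z) - n * q)^2)
      \<partial>pair_pmf (Poi (n * p)) (Poi (n * q)))
    = (\<integral>\<^sup>+ x. \<integral>\<^sup>+ y. ennreal ((real x - n * p)^2) + ennreal ((real y - n * q)^2)
      \<partial>Poi (n * q) \<partial>Poi (n * p))"
    by (simp add: nn_integral_pair_pmf')
  also have "\<dots> = ennreal (n * p) + ennreal (n * q)"
    using assms by (simp add: nn_integral_add nn_integral_Poi_centered_square)
  finally show ?thesis
    using assms by (simp add: algebra_simps)
qed

lemma plug_in_risk_le:
  assumes p: "p \<in> prob_vectors S" and q: "q \<in> prob_vectors S" and n: "0 < n"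
  shows "plug_in_risk S n p q \<le> ennreal (4 * (real S / real n))"
proof -
  let ?M = "poisson_sampling S n p q"
  define w where "w i x y = (real x - real n * p i)^2 + (real y - real n * q i)^2" for i x y
  define C where "C = 2 * real S / (real n)^2"
  have C: "C \<ge> 0" by (simp add: C_def)
  have w: "w i x y \<ge> 0" for i x y by (simp add: w_def)
  have pq: "0 \<le> p i" "0 \<le> q i" if "i \<in> {1..S}" for i
    using that p q unfolding prob_vectors_def by blast+
  have pointwise: "\<bar>plug_in S n X Y - l1_dist S p q\<bar>\<^sup>2 \<le> C * (\<Sum>i=1..S. w i (X i) (Y i))" for X Y
  proof -
    define e where "e i = (real (X i) - real (Y i)) / n - (p i - q i)" for i
    have e: "(e i)^2 \<le> 2 / (real n)^2 * w i (X i) (Y i)" for i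
    proof -
      define u v where "u = real (X i) - real n * p i" and "v = real (Y i) - real n * q i"
      have "e i = (u - v) / n"
        using n by (simp add: e_def u_def v_def field_simps)
      moreover have "(u - v)^2 \<le> 2 * (u^2 + v^2)"
        using zero_le_power2[of "u + v"] by (simp add: power2_eq_square algebra_simps)
      ultimately show ?thesis
        using n by (simp add: w_def u_def[symmetric] v_def[symmetric] power_divide divide_right_mono)
    qed
    have "\<bar>plug_in S n X Y - l1_dist S p q\<bar>
        = \<bar>\<Sum>i=1..S. \<bar>(real (X i) - real (Y i)) / n\<bar> - \<bar>p i - q i\<bar>\<bar>"
      by (simp add: plug_in_def l1_dist_def empirical_def sum_subtractf diff_divide_distrib)
    also have "\<dots> \<le> (\<Sum>i=1..S. \<bar>e i\<bar>)"
      unfolding e_def by (rule order_trans[OF sum_abs]) (intro sum_mono abs_triangle_ineq3)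
    finally have "\<bar>plug_in S n X Y - l1_dist S p q\<bar>\<^sup>2 \<le> (\<Sum>i=1..S. \<bar>e i\<bar>)^2"
      by (intro power_mono) auto
    also have "\<dots> \<le> real S * (\<Sum>i=1..S. (e i)^2)"
      using Cauchy_Schwarz_ineq_sum[of "\<lambda>_. 1" "\<lambda>i. \<bar>e i\<bar>" "{1..S}"] by simp
    also have "\<dots> \<le> real S * (\<Sum>i=1..S. 2 / (real n)^2 * w i (X i) (Y i))"
      by (intro mult_left_mono sum_mono e) auto
    also have "\<dots> = C * (\<Sum>i=1..S. w i (X i) (Y i))"
      by (simp add: C_def sum_distrib_left[symmetric] sum_divide_distrib[symmetric])
    finally show ?thesis .
  qed
  have "plug_in_risk S n p q
      \<le> (\<integral>\<^sup>+ \<omega>. ennreal C * (\<Sum>i=1..S. ennreal (w i (fst \<omega> i) (snd \<omega> i))) \<partial>?M)"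
    unfolding plug_in_risk_def
  proof (intro nn_integral_mono)
    fix \<omega>
    show "ennreal (\<bar>plug_in S n (fst \<omega>) (snd \<omega>) - l1_dist S p q\<bar>\<^sup>2)
        \<le> ennreal C * (\<Sum>i=1..S. ennreal (w i (fst \<omega> i) (snd \<omega> i)))"
      using ennreal_leI[OF pointwise[of "fst \<omega>" "snd \<omega>"]] C w
      by (simp add: ennreal_mult sum_nonneg sum_ennreal)
  qed
  also have "\<dots> = ennreal C * (\<Sum>i=1..S. \<integral>\<^sup>+ \<omega>. ennreal (w i (fst \<omega> i) (snd \<omega> i)) \<partial>?M)"
    by (simp add: nn_integral_cmult nn_integral_sum)
  also have "(\<Sum>i=1..S. \<integral>\<^sup>+ \<omega>. ennreal (w i (fst \<omega> i) (snd \<omega> i)) \<partial>?M)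
      = (\<Sum>i=1..S. ennreal (real n * (p i + q i)))"
  proof (intro sum.cong refl)
    fix i assume i: "i \<in> {1..S}"
    show "(\<integral>\<^sup>+ \<omega>. ennreal (w i (fst \<omega> i) (snd \<omega> i)) \<partial>?M) = ennreal (real n * (p i + q i))"
      using nn_integral_poisson_sampling_component[OF i, where f = "\<lambda>x y. ennreal (w i x y)"]
        nn_integral_pair_centered_squares[of "p i" "q i" "real n"] pq[OF i] n
      by (simp add: w_def)
  qed
  also have "\<dots> = ennreal (\<Sum>i=1..S. real n * (p i + q i))"
    using pq by (intro sum_ennreal) simp
  also have "(\<Sum>i=1..S. real n * (p i + q i)) = 2 * real n"
    using p q by (simp add: sum_distrib_left[symmetric] sum.distrib prob_vectors_def)
  also have "ennreal C * ennreal (2 * real n) = ennreal (4 * (real S / real n))"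
    using n by (simp add: C_def ennreal_mult[symmetric] power2_eq_square)
  finally show ?thesis .
qed

text \<open>
  Integrating \<open>2 m f \<le> f\<^sup>2 + m\<^sup>2\<close> gives the bound also when the integrals are infinite.
\<close>

lemma nn_integral_square_ge:
  fixes f :: "'a \<Rightarrow> real"
  assumes m: "0 \<le> m" "ennreal m \<le> (\<integral>\<^sup>+ x. ennreal (f x) \<partial>measure_pmf M)" and f: "\<And>x. 0 \<le> f x"
  shows "ennreal (m^2) \<le> (\<integral>\<^sup>+ x. ennreal ((f x)^2) \<partial>measure_pmf M)"
proof -
  have "ennreal (m^2) + ennreal (m^2) = ennreal (2 * m) * ennreal m"
    using m by (simp add: ennreal_mult[symmetric] ennreal_plus[symmetric] power2_eq_square del: ennreal_plus)
  also have "\<dots> \<le> ennreal (2 * m) * (\<integral>\<^sup>+ x. ennreal (f x) \<partial>M)"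
    by (intro mult_left_mono m) auto
  also have "\<dots> = (\<integral>\<^sup>+ x. ennreal (2 * m * f x) \<partial>M)"
    using m f by (simp add: nn_integral_cmult[symmetric] ennreal_mult)
  also have "\<dots> \<le> (\<integral>\<^sup>+ x. ennreal ((f x)^2) + ennreal (m^2) \<partial>M)"
  proof (intro nn_integral_mono)
    fix x
    have "2 * m * f x \<le> (f x)^2 + m^2"
      using zero_le_power2[of "f x - m"] by (simp add: power2_eq_square algebra_simps)
    then show "ennreal (2 * m * f x) \<le> ennreal ((f x)^2) + ennreal (m^2)"
      by (simp add: ennreal_plus[symmetric] ennreal_leI del: ennreal_plus)
  qed
  also have "\<dots> = (\<integral>\<^sup>+ x. ennreal ((f x)^2) \<partial>M) + ennreal (m^2)"
    by (simp add: nn_integral_add)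
  finally show ?thesis
    by (simp add: add.commute ennreal_add_left_cancel_le)
qed

lemma plug_in_risk_uniform_ge:
  assumes S: "0 < S" and n: "0 < n"
  defines "u \<equiv> \<lambda>i. if i \<in> {1..S} then 1 / real S else 0"
  shows "u \<in> prob_vectors S"
    and "ennreal (real S / (8 * (real S + 3 * real n))) \<le> plug_in_risk S n u u"
proof -
  show "u \<in> prob_vectors S"
    using S by (auto simp: prob_vectors_def u_def)
  let ?M = "poisson_sampling S n u u"
  define r where "r = real n / real S"
  define b where "b = r / (2 * sqrt (2 * (1 + 3 * r)))"
  have r: "r > 0" and b: "b \<ge> 0"
    using S n by (auto simp: r_def b_def)
  have rate: "real n * u i = r" if "i \<in> {1..S}" for i
    using that by (simp add: u_def r_def)
  have mean: "ennreal (real S / real n * b)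
      \<le> (\<integral>\<^sup>+ \<omega>. ennreal (plug_in S n (fst \<omega>) (snd \<omega>)) \<partial>?M)"
  proof -
    have plug_in: "ennreal (plug_in S n X Y)
        = ennreal (1 / real n) * (\<Sum>i=1..S. ennreal \<bar>real (X i) - real (Y i)\<bar>)" for X Y
      by (simp add: plug_in_def l1_dist_def empirical_def sum_ennreal ennreal_mult[symmetric] sum_nonneg
          diff_divide_distrib[symmetric] sum_divide_distrib)
    have "ennreal (real S / real n * b) = ennreal (1 / real n) * (\<Sum>i=1..S. ennreal b)"
      using b by (simp add: ennreal_mult[symmetric] ennreal_of_nat_eq_real_of_nat)
    also have "\<dots> \<le> ennreal (1 / real n)
        * (\<Sum>i=1..S. \<integral>\<^sup>+ \<omega>. ennreal \<bar>real (fst \<omega> i) - real (snd \<omega> i)\<bar> \<partial>?M)"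
    proof (intro mult_left_mono sum_mono)
      fix i assume i: "i \<in> {1..S}"
      show "ennreal b \<le> (\<integral>\<^sup>+ \<omega>. ennreal \<bar>real (fst \<omega> i) - real (snd \<omega> i)\<bar> \<partial>?M)"
        using Poi_mean_abs_difference_ge[of r] r
          nn_integral_poisson_sampling_component[OF i, where f = "\<lambda>x y. ennreal \<bar>real x - real y\<bar>"]
        by (simp add: b_def rate[OF i])
    qed auto
    also have "\<dots> = (\<integral>\<^sup>+ \<omega>. ennreal (plug_in S n (fst \<omega>) (snd \<omega>)) \<partial>?M)"
      by (simp add: plug_in nn_integral_cmult nn_integral_sum del: sum_ennreal)
    finally show ?thesis .
  qed
  have "(real S / real n * b)^2 = real S / (8 * (real S + 3 * real n))"
  proof -
    have "b^2 = r^2 / (8 * (1 + 3 * r))"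
      using r by (simp add: b_def power_divide power_mult_distrib)
    then have "(real S / real n * b)^2 = (real S / real n * r)^2 / (8 * (1 + 3 * r))"
      by (simp only: power_mult_distrib times_divide_eq_right)
    also have "real S / real n * r = 1"
      using S n by (simp add: r_def)
    also have "1^2 / (8 * (1 + 3 * r)) = real S / (8 * (real S + 3 * real n))"
      using S n by (simp add: r_def field_simps)
    finally show ?thesis .
  qed
  then have "ennreal (real S / (8 * (real S + 3 * real n)))
      \<le> (\<integral>\<^sup>+ \<omega>. ennreal ((plug_in S n (fst \<omega>) (snd \<omega>))^2) \<partial>?M)"
    using nn_integral_square_ge[OF _ mean] b
    by (simp add: plug_in_def l1_dist_def sum_nonneg)
  also have "\<dots> = plug_in_risk S n u u"
    by (simp add: plug_in_risk_def l1_dist_def)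
  finally show "ennreal (real S / (8 * (real S + 3 * real n))) \<le> plug_in_risk S n u u" .
qed

theorem theorem5:
  shows "\<forall>c::real. 0 < c \<longrightarrow>
    (\<exists>a A::real. 0 < a \<and> a \<le> A \<and>
      (\<forall>S n::nat. 0 < S \<longrightarrow> 0 < n \<longrightarrow> c * real S \<le> real n \<longrightarrow>
        ennreal (a * (real S / real n)) \<le> plug_in_max_risk S n \<and>
        plug_in_max_risk S n \<le> ennreal (A * (real S / real n))))"
proof (intro allI impI)
  fix c :: real assume c: "0 < c"
  \<comment> \<open>Bounding \<open>S\<close> by \<open>n / c\<close> in the denominator of the lower bound \<open>S / (8 * (S + 3 * n))\<close>.\<close>
  define a where "a = 1 / (8 * (1 / c + 3))"
  have a: "0 < a" "a \<le> 4"
  proof -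
    have "1 \<le> 8 * (1 / c + 3)"
      using c by (simp add: add_increasing)
    then show "0 < a" "a \<le> 4"
      by (auto simp: a_def divide_simps)
  qed
  show "\<exists>a A::real. 0 < a \<and> a \<le> A \<and>
      (\<forall>S n::nat. 0 < S \<longrightarrow> 0 < n \<longrightarrow> c * real S \<le> real n \<longrightarrow>
        ennreal (a * (real S / real n)) \<le> plug_in_max_risk S n \<and>
        plug_in_max_risk S n \<le> ennreal (A * (real S / real n)))"
  proof (rule exI[of _ a], rule exI[of _ 4], intro conjI a allI impI)
    fix S n :: nat assume S: "0 < S" and n: "0 < n" and cS: "c * real S \<le> real n"
    have "real S + 3 * real n \<le> (1 / c + 3) * real n"
      using c cS by (simp add: field_simps)
    then have "real S / (8 * ((1 / c + 3) * real n)) \<le> real S / (8 * (real S + 3 * real n))"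
      using S by (intro divide_left_mono mult_left_mono) auto
    then have "ennreal (a * (real S / real n)) \<le> ennreal (real S / (8 * (real S + 3 * real n)))"
      by (intro ennreal_leI) (simp add: a_def mult.assoc del: distrib_left_numeral)
    also have "\<dots> \<le> plug_in_max_risk S n"
    proof -
      obtain u where "u \<in> prob_vectors S"
        and "ennreal (real S / (8 * (real S + 3 * real n))) \<le> plug_in_risk S n u u"
        using plug_in_risk_uniform_ge[OF S n] by blast
      then show ?thesis
        unfolding plug_in_max_risk_def by (intro SUP_upper2[of "(u, u)"]) auto
    qed
    finally show "ennreal (a * (real S / real n)) \<le> plug_in_max_risk S n" .
    show "plug_in_max_risk S n \<le> ennreal (4 * (real S / real n))"
      unfolding plug_in_max_risk_def using plug_in_risk_le n
      by (intro SUP_least) auto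
  qed
qed

end
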